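(* Let $m$ be a positive integer, let $n=2m$ or $n=2m+1$, and let $F(x)=x^{2^{m+1}-1}$ be the power mapping on $\mathbb{F}_{2^n}$. Then the Feistel boomerang uniformity of $F$ satisfies $$\beta_c(F)=\begin{cases}2^m,&\text{if }n=2m;\\ 0,&\text{if }n=2m+1.\end{cases}$$
   Context: $\mathbb{F}_{2^n}$ is the finite field with $2^n$ elements. For a mapping $F:\mathbb{F}_{2^n}\to\mathbb{F}_{2^n}$ and $(a,b)\in\mathbb{F}_{2^n}^2$, the Feistel Boomerang Connectivity Table (FBCT) entry is $$\mathrm{FBCT}_F(a,b)=|\{x\in\mathbb{F}_{2^n}:F(x)+F(x+a)+F(x+b)+F(x+a+b)=0\}|.$$ The Feistel boomerang uniformity of $F$ is $$\beta_c(F)=\max_{a,b\in\mathbb{F}_{2^n},\ ab(a+b)\neq 0}\mathrm{FBCT}_F(a,b).$$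
   Formalization: The case m = 1, n = 2 is excluded, because there the claim fails: for F(x) = x^3 on the field with 4 elements every FBCT entry with ab(a+b) ≠ 0 is 0, so the uniformity is 0 and not 2. *)

theory Defs
  imports Complex_Main "HOL-Library.Cardinality"
begin

text \<open>
  The field with \<open>2 ^ n\<close> elements is represented by an arbitrary type of class \<open>{field, finite}\<close>
  with \<open>CARD('a) = 2 ^ n\<close>.  The two definitions make sense over every finite field, but they are
  the notions of the literature in characteristic 2 only.
\<close>

definition FBCT :: "('a::{field,finite} \<Rightarrow> 'a) \<Rightarrow> 'a \<Rightarrow> 'a \<Rightarrow> nat" where
  "FBCT F a b = card {x. F x + F (x + a) + F (x + b) + F (x + a + b) = 0}"

text \<open>
  In characteristic 2 the set below is nonempty as soon as the field has at least 4 elements;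
  over the field with 2 elements it is empty and the value of \<open>Max\<close> is meaningless.
\<close>

definition feistel_boomerang_uniformity :: "('a::{field,finite} \<Rightarrow> 'a) \<Rightarrow> nat" where
  "feistel_boomerang_uniformity F = Max {FBCT F a b | a b. a * b * (a + b) \<noteq> 0}"

text \<open>
  Small case: over the field with 4 elements \<open>x ^ 3\<close> is 1 except at 0, and for admissible \<open>a\<close>, \<open>b\<close>
  the points \<open>x\<close>, \<open>x + a\<close>, \<open>x + b\<close>, \<open>x + a + b\<close> are all the elements, so their cubes sum to 1 and
  the uniformity is 0.  Thus for \<open>m = 1\<close>, \<open>n = 2\<close> the formula \<open>2 ^ m\<close> for the uniformity of
  \<open>x ^ (2 ^ (m + 1) - 1)\<close> fails; this case has to be excluded by \<open>n \<noteq> 2\<close>.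
\<close>

end

theory Submission
  imports Defs "HOL-Number_Theory.Residues" "HOL-Computational_Algebra.Polynomial"
begin

text \<open>
  Write \<open>\<sigma> x = x ^ (2 ^ (m + 1))\<close>, so that \<open>F x = \<sigma> x / x\<close>, and normalise \<open>a = 1\<close>.
  Clearing denominators, a point \<open>x\<close> outside \<open>{0, 1, b, b + 1}\<close> is counted iff
  \<open>(b\<^sup>2 + b) (\<sigma> x + x) = (\<sigma> b + b) (x\<^sup>2 + x)\<close>, while the four remaining points are counted iff
  \<open>\<sigma> b = b\<^sup>2\<close>.  If \<open>\<sigma> b = b\<^sup>2\<close>, the counted points are thus exactly those with \<open>\<sigma> x = x\<^sup>2\<close>.
  Otherwise put \<open>c = (\<sigma> b + b) / (b\<^sup>2 + b)\<close> and \<open>y = x\<^sup>2 + x\<close>: applying \<open>\<sigma>\<close> to \<open>\<sigma> x = x + c y\<close>, where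
  \<open>\<sigma> (\<sigma> x)\<close> is \<open>x ^ 4\<close> or \<open>x\<^sup>2\<close>, gives a linear equation that determines \<open>y\<close> from \<open>c\<close>, so
  no point is counted.
  For \<open>n = 2 m\<close> the condition \<open>\<sigma> x = x\<^sup>2\<close> defines the subfield with \<open>2 ^ m\<close> elements, for
  \<open>n = 2 m + 1\<close> the prime field.
\<close>

section \<open>Finite fields of characteristic 2\<close>

text \<open>Multiplication by a nonzero \<open>x\<close> permutes the units, so it leaves their
  product unchanged.\<close>

lemma finite_field_power_CARD:
  fixes x :: "'a::{field,finite}"
  shows "x ^ CARD('a) = x"
proof (cases "x = 0")
  case True
  then show ?thesis
    by (simp add: power_0_left)
next
  case False
  let ?U = "UNIV - {0::'a}"
  have "bij_betw ((*) x) ?U ?U"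
    by (rule bij_betwI[where g = "\<lambda>y. y / x"]) (use False in auto)
  then have "(\<Prod>y\<in>?U. x * y) = \<Prod>?U"
    by (rule prod.reindex_bij_betw)
  then have "x ^ card ?U = 1"
    by (simp add: prod.distrib)
  moreover have "CARD('a) = Suc (card ?U)"
    by (rule card.remove) simp_all
  ultimately show ?thesis
    by (simp only: power_Suc mult_1_right)
qed

lemma CHAR_eq_2:
  assumes "CARD('a::{field,finite}) = 2 ^ n"
  shows "CHAR('a) = 2"
proof -
  have "prime CHAR('a)"
    by (intro prime_CHAR_semidom finite_imp_CHAR_pos) simp
  moreover have "CHAR('a) dvd 2 ^ n"
    using CHAR_dvd_CARD[where ?'a = 'a] assms by simp
  ultimately show ?thesis
    by (metis prime_dvd_power primes_dvd_imp_eq two_is_prime_nat)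
qed

lemma add_self_CHAR_2: "CHAR('a::comm_ring_1) = 2 \<Longrightarrow> x + x = (0::'a)"
  by (metis mult_2 mult_zero_left of_nat_CHAR of_nat_numeral)

lemma power_2_power_add_CHAR_2:
  "CHAR('a::comm_ring_1) = 2 \<Longrightarrow> (x + y :: 'a) ^ (2 ^ k) = x ^ (2 ^ k) + y ^ (2 ^ k)"
  by (rule freshmans_dream') simp_all

text \<open>
  The map \<open>x \<mapsto> x ^ q + x\<close> is additive with kernel \<open>K\<close> and, as \<open>x ^ (q\<^sup>2) = x\<close>, takes values
  in \<open>K\<close>; hence the whole field has at most \<open>(card K)\<^sup>2\<close> elements.
\<close>
lemma card_subfield:
  assumes card: "CARD('a::{field,finite}) = 2 ^ (2 * m)" and m: "m > 0"
  shows "card {x::'a. x ^ (2 ^ m) = x} = 2 ^ m"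
proof -
  define q :: nat where "q = 2 ^ m"
  define K where "K = {x::'a. x ^ q = x}"
  define t where "t = (\<lambda>x::'a. x ^ q + x)"
  have char2: "CHAR('a) = 2"
    using card by (rule CHAR_eq_2)
  have q: "q > 1"
    unfolding q_def using m by (intro one_less_power) simp_all
  have add: "(x + y) ^ q = x ^ q + y ^ q" for x y :: 'a
    unfolding q_def by (rule power_2_power_add_CHAR_2[OF char2])
  have t_eq_iff: "t x = t y \<longleftrightarrow> x - y \<in> K" for x y
  proof -
    have uminus: "- z = z" for z :: 'a
      by (rule minus_unique) (rule add_self_CHAR_2[OF char2])
    have "t x = t y \<longleftrightarrow> x ^ q - y ^ q = - (x - y)"
      unfolding t_def by (auto simp: algebra_simps)
    also have "- (x - y) = x - y"
      by (rule uminus)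
    also have "x ^ q - y ^ q = (x - y) ^ q"
      using add[of "x - y" y] by (simp add: algebra_simps)
    finally show ?thesis
      by (simp add: K_def)
  qed
  have "t x \<in> K" for x
  proof -
    have "(x ^ q) ^ q = x"
      using finite_field_power_CARD[of x]
      by (simp add: card q_def mult_2 flip: power_mult power_add)
    then show ?thesis
      by (simp add: K_def t_def add add.commute)
  qed
  then have "UNIV = (\<Union>z\<in>K. t -` {z})"
    by auto
  then have "CARD('a) \<le> (\<Sum>z\<in>K. card (t -` {z}))"
    using card_UN_le[of K "\<lambda>z. t -` {z}"] by (simp only: finite)
  also have "\<dots> \<le> (\<Sum>z\<in>K. card K)"
  proof (rule sum_mono)
    fix z
    show "card (t -` {z}) \<le> card K"
    proof (cases "t -` {z} = {}")
      case False
      then obtain w where w: "t w = z"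
        by auto
      have "(\<lambda>x. x - w) ` (t -` {z}) \<subseteq> K"
        using w t_eq_iff by auto
      then show ?thesis
        by (intro card_inj_on_le) (auto simp: inj_on_def)
    qed simp
  qed
  finally have "q ^ 2 \<le> card K ^ 2"
    by (simp add: card q_def power2_eq_square mult_2 power_add)
  then have "q \<le> card K"
    by (rule power2_le_imp_le) simp
  \<comment> \<open>\<open>K\<close> is the root set of \<open>p\<close>, a nonzero polynomial of
    degree at most \<open>q\<close>.\<close>
  moreover have "card K \<le> q"
  proof -
    define p where "p = monom (1::'a) q - monom 1 1"
    have "coeff p q = 1"
      using q by (simp add: p_def)
    then have "p \<noteq> 0"
      by auto
    have "degree p \<le> q"
      unfolding p_def using q by (intro degree_diff_le order.trans[OF degree_monom_le]) auto
    moreover have "K = {x. poly p x = 0}"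
      by (simp add: K_def p_def poly_monom)
    ultimately show ?thesis
      using card_poly_roots_bound[OF \<open>p \<noteq> 0\<close>] by simp
  qed
  ultimately show ?thesis
    by (simp add: K_def q_def)
qed

section \<open>Quotients of a field endomorphism by the identity\<close>

text \<open>Substituting \<open>a * x\<close> for \<open>x\<close> pulls the factor
  \<open>F a\<close> out of the sum; this permits the normalisation \<open>a = 1\<close>.\<close>

lemma FBCT_scale:
  fixes F :: "'a::{field,finite} \<Rightarrow> 'a"
  assumes mult: "\<And>x y. F (x * y) = F x * F y" and "F a \<noteq> 0" "a \<noteq> 0"
  shows "FBCT F a b = FBCT F 1 (b / a)"
proof -
  let ?D = "\<lambda>a b x. F x + F (x + a) + F (x + b) + F (x + a + b)"
  have D: "?D a b (a * x) = F a * ?D 1 (b / a) x" for x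
  proof -
    have "a * x + a = a * (x + 1)" "a * x + b = a * (x + b / a)"
      "a * x + a + b = a * (x + 1 + b / a)"
      using \<open>a \<noteq> 0\<close> by (simp_all add: field_simps)
    then show ?thesis
      by (simp only: mult distrib_left[of "F a"])
  qed
  have "bij_betw ((*) a) {x. ?D 1 (b / a) x = 0} {x. ?D a b x = 0}"
  proof (rule bij_betwI[where g = "\<lambda>y. y / a"])
    show "(\<lambda>y. y / a) \<in> {x. ?D a b x = 0} \<rightarrow> {x. ?D 1 (b / a) x = 0}"
    proof
      fix y assume "y \<in> {x. ?D a b x = 0}"
      moreover have "a * (y / a) = y"
        using \<open>a \<noteq> 0\<close> by simp
      ultimately show "y / a \<in> {x. ?D 1 (b / a) x = 0}"
        using D[of "y / a"] \<open>F a \<noteq> 0\<close> by simp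
    qed
  qed (use D \<open>a \<noteq> 0\<close> in auto)
  then show ?thesis
    unfolding FBCT_def by (simp add: bij_betw_same_card)
qed

text \<open>An arbitrary ring endomorphism stands in for the Frobenius power; the parity of
  \<open>n\<close> will matter only through the form of \<open>s (s x)\<close>.\<close>

locale char2_endomorphism =
  fixes s :: "'a::{field,finite} \<Rightarrow> 'a"
  assumes char2: "CHAR('a) = 2"
    and s_add: "s (x + y) = s x + s y"
    and s_mult: "s (x * y) = s x * s y"
    and s_1 [simp]: "s 1 = 1"
begin

lemma add_self [simp]: "x + x = (0::'a)"
  using char2 by (rule add_self_CHAR_2)

lemma add_self_left [simp]: "x + (x + y) = (y::'a)"
  by (simp flip: add.assoc)

text \<open>
  After sorting by associativity and commutativity, the rule \<open>add_self_left\<close> cancels equal monomials pairwise, so the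
  simplifier decides polynomial identities in characteristic 2.
\<close>
lemmas char2_simps = distrib_left distrib_right ac_simps power2_eq_square power4_eq_xxxx

lemma add_eq_0_iff_eq: "x + y = 0 \<longleftrightarrow> x = (y::'a)"
  by (metis add_self add_self_left add_0_right)

lemma s_0 [simp]: "s 0 = 0"
  by (metis add_self s_add)

lemma s_eq_0_iff [simp]: "s x = 0 \<longleftrightarrow> x = 0"
  by (metis mult_zero_left right_inverse s_0 s_1 s_mult zero_neq_one)

lemma s_eq_iff [simp]: "s x = s y \<longleftrightarrow> x = y"
  by (metis add_eq_0_iff_eq s_add s_eq_0_iff)

lemma square_add_self_eq_0_iff: "x^2 + x = 0 \<longleftrightarrow> x = 0 \<or> x = (1::'a)"
proof -
  have "x^2 + x = x * (x + 1)"
    by (simp add: char2_simps)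
  then show ?thesis
    by (simp add: add_eq_0_iff_eq)
qed

text \<open>\<open>x^2 + x\<close> is additive in \<open>x\<close> with kernel
  \<open>{0, 1}\<close>.\<close>

lemma square_add_self_eq_iff: "x^2 + x = y^2 + y \<longleftrightarrow> x = y \<or> x = y + (1::'a)"
proof -
  have "x^2 + x + (y^2 + y) = (x + y)^2 + (x + y)"
    by (simp add: char2_simps)
  then have "x^2 + x = y^2 + y \<longleftrightarrow> x + y = 0 \<or> x + y = 1"
    by (metis add_eq_0_iff_eq square_add_self_eq_0_iff)
  then show ?thesis
    by (metis add.commute add_eq_0_iff_eq add_self_left)
qed

text \<open>At 0 this is \<open>0 / 0 = 0\<close>, which agrees with the value of the power map there.\<close>
definition quot :: "'a \<Rightarrow> 'a" where
  "quot x = s x / x"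

lemma quot_mult: "quot (x * y) = quot x * quot y"
  by (simp add: quot_def s_mult)

text \<open>\<open>X\<close>, \<open>B\<close> stand for \<open>s x\<close>, \<open>s b\<close>, and
  \<open>u\<close>, \<open>v\<close>, \<open>w\<close>, \<open>z\<close> for the four quotients; in
  product form, clearing denominators is a polynomial identity.\<close>

lemma numerator_identity:
  fixes x b X B :: 'a
  assumes "x * u = X" "(x + 1) * v = X + 1" "(x + b) * w = X + B" "(x + 1 + b) * z = X + 1 + B"
  shows "x * (x + 1) * (x + b) * (x + 1 + b) * (u + v + w + z) =
    (b^2 + b) * (X + x) + (B + b) * (x^2 + x)"
proof -
  have "x * (x + 1) * (x + b) * (x + 1 + b) * (u + v + w + z) =
      (x + 1) * (x + b) * (x + 1 + b) * (x * u) + x * (x + b) * (x + 1 + b) * ((x + 1) * v) +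
      x * (x + 1) * (x + 1 + b) * ((x + b) * w) + x * (x + 1) * (x + b) * ((x + 1 + b) * z)"
    by (simp only: distrib_left distrib_right ac_simps)
  also have "\<dots> = (b^2 + b) * (X + x) + (B + b) * (x^2 + x)"
    unfolding assms by (simp add: char2_simps)
  finally show ?thesis .
qed

lemma quot_sum_generic:
  assumes "x \<notin> {0, 1, b, b + 1}"
  shows "quot x + quot (x + 1) + quot (x + b) + quot (x + 1 + b) = 0 \<longleftrightarrow>
    (b^2 + b) * (s x + x) = (s b + b) * (x^2 + x)"
proof -
  have nz: "x \<noteq> 0" "x + 1 \<noteq> 0" "x + b \<noteq> 0" "x + 1 + b \<noteq> 0"
    using assms by (auto simp: add_eq_0_iff_eq add.assoc add.commute)
  have "x * (x + 1) * (x + b) * (x + 1 + b) *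
      (quot x + quot (x + 1) + quot (x + b) + quot (x + 1 + b)) =
    (b^2 + b) * (s x + x) + (s b + b) * (x^2 + x)"
    by (rule numerator_identity) (use nz in \<open>simp_all add: quot_def flip: s_add, simp_all add: s_add\<close>)
  then show ?thesis
    using nz by (metis add_eq_0_iff_eq mult_eq_0_iff)
qed

text \<open>Adding \<open>1\<close> or \<open>b\<close> permutes the four points, so the sum can be
  evaluated at 0, where \<open>quot 0 = 0\<close>.\<close>

lemma quot_sum_special:
  assumes b: "b \<notin> {0, 1}" and x: "x \<in> {0, 1, b, b + 1}"
  shows "quot x + quot (x + 1) + quot (x + b) + quot (x + 1 + b) = 0 \<longleftrightarrow> s b = b^2"
proof -
  have nz: "b \<noteq> 0" "b + 1 \<noteq> 0"
    using b by (auto simp: add_eq_0_iff_eq)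
  have "quot x + quot (x + 1) + quot (x + b) + quot (x + 1 + b) =
      quot 0 + quot 1 + quot b + quot (b + 1)"
    using x by (auto simp: ac_simps)
  then have "b * (b + 1) * (quot x + quot (x + 1) + quot (x + b) + quot (x + 1 + b)) =
      b * (b + 1) * (1 + s b / b + (s b + 1) / (b + 1))"
    by (simp add: quot_def s_add)
  also have "\<dots> = b * (b + 1) + (b + 1) * (b * (s b / b)) + b * ((b + 1) * ((s b + 1) / (b + 1)))"
    by (simp only: distrib_left distrib_right ac_simps mult_1_left mult_1_right)
  also have "\<dots> = b * (b + 1) + (b + 1) * s b + b * (s b + 1)"
    using nz by simp
  also have "\<dots> = s b + b^2"
    by (simp add: char2_simps)
  finally show ?thesis
    using nz by (metis add_eq_0_iff_eq mult_eq_0_iff)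
qed

text \<open>For \<open>s x = x + c * y\<close> and \<open>d = s c\<close>, the left side of
  \<open>eq\<close> is \<open>s (s x)\<close>. After adding \<open>x\<close> to it, \<open>y\<close>
  can be cancelled, which leaves an equation linear in \<open>y\<close> with coefficients in
  \<open>c\<close> and \<open>d\<close> only.\<close>

lemma quadratic_expression_determined:
  fixes x y c d :: 'a
  assumes y: "y = x^2 + x" and eq: "x + c * y + d * ((x + c * y)^2 + (x + c * y)) = e"
    and "y \<noteq> 0"
  shows "e = x^2 \<Longrightarrow> d * c^2 * y = (1 + c) * (1 + d)"
    and "e = x^4 \<Longrightarrow> (1 + c^2 * d) * y = (1 + c) * (1 + d)"
proof -
  have "x + (x + c * y + d * ((x + c * y)^2 + (x + c * y))) = y * (c + d * (1 + c + c^2 * y))"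
    unfolding y by (simp add: char2_simps)
  then have *: "y * (c + d * (1 + c + c^2 * y)) = x + e"
    by (simp add: eq)
  {
    assume "e = x^2"
    then have "y * (c + d * (1 + c + c^2 * y)) = y * 1"
      using * by (simp add: y add.commute)
    then have one: "c + d * (1 + c + c^2 * y) = 1"
      using \<open>y \<noteq> 0\<close> by simp
    have "(1 + c) * (1 + d) = 1 + (c + d + c * d)"
      by (simp add: char2_simps)
    also have "\<dots> = c + d * (1 + c + c^2 * y) + (c + d + c * d)"
      by (simp only: one)
    also have "\<dots> = d * c^2 * y"
      by (simp add: char2_simps)
    finally show "d * c^2 * y = (1 + c) * (1 + d)" ..
  }
  {
    assume "e = x^4"
    \<comment> \<open>Here \<open>x + x^4 = y + y^2\<close>.\<close>
    then have "y * (c + d * (1 + c + c^2 * y)) = y * (1 + y)"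
      using * by (simp add: y char2_simps)
    then have one: "c + d * (1 + c + c^2 * y) = 1 + y"
      using \<open>y \<noteq> 0\<close> by simp
    have "(1 + c) * (1 + d) = (1 + y) + (y + c + d + c * d)"
      by (simp add: char2_simps)
    also have "\<dots> = c + d * (1 + c + c^2 * y) + (y + c + d + c * d)"
      by (simp only: one)
    also have "\<dots> = (1 + c^2 * d) * y"
      by (simp add: char2_simps)
    finally show "(1 + c^2 * d) * y = (1 + c) * (1 + d)" ..
  }
qed

text \<open>The point \<open>b\<close> satisfies the same equation as \<open>x\<close>, with the
  same \<open>c\<close>. Both \<open>x^2 + x\<close> and \<open>b^2 + b\<close> therefore solve one
  linear equation, and it remains to see that its leading coefficient is nonzero.\<close>

lemma proportional_imp_coset:
  assumes ss: "(\<forall>x. s (s x) = x^2) \<or> (\<forall>x. s (s x) = x^4)"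
    and b: "b \<notin> {0, 1}" "s b \<noteq> b^2" and x: "x \<notin> {0, 1}"
    and eq: "(b^2 + b) * (s x + x) = (s b + b) * (x^2 + x)"
  shows "x = b \<or> x = b + 1"
proof -
  have nz: "b^2 + b \<noteq> 0" "x^2 + x \<noteq> 0"
    using b(1) x by (simp_all add: square_add_self_eq_0_iff)
  define c where "c = (s b + b) / (b^2 + b)"
  have sb: "s b = b + c * (b^2 + b)"
    using nz by (simp add: c_def add.commute[of "s b"])
  have "s x + x = c * (x^2 + x)"
    using eq nz by (simp add: c_def field_simps)
  then have sx: "s x = x + c * (x^2 + x)"
    by (metis add.commute add_self_left)
  have ss_expand: "z + c * (z^2 + z) + s c * ((z + c * (z^2 + z))^2 + (z + c * (z^2 + z))) = s (s z)"
    if "s z = z + c * (z^2 + z)" for z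
  proof -
    have "s (s z) = s (z + c * (z^2 + z))"
      by (simp only: that)
    also have "\<dots> = s z + s c * ((s z)^2 + s z)"
      by (simp add: s_add s_mult power2_eq_square)
    finally show ?thesis
      by (simp add: that)
  qed
  note det = quadratic_expression_determined[OF refl ss_expand]
  have "c \<noteq> 1"
  proof
    assume "c = 1"
    then have "s b = b + (b + b^2)"
      using sb by (simp add: add.commute)
    then show False
      using b(2) by (simp only: add_self_left)
  qed
  from ss have "x^2 + x = b^2 + b"
  proof
    assume sq: "\<forall>x. s (s x) = x^2"
    have "c \<noteq> 0"
    proof
      assume "c = 0"
      then have "b^2 = b"
        using sb sq by (metis add.right_neutral mult_zero_left)
      then show False
        using nz by simp
    qed
    have "s c * c^2 * (x^2 + x) = s c * c^2 * (b^2 + b)"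
      using det(1)[OF sx nz(2)] det(1)[OF sb nz(1)] sq by simp
    then show ?thesis
      using \<open>c \<noteq> 0\<close> by simp
  next
    assume four: "\<forall>x. s (s x) = x^4"
    \<comment> \<open>A nonzero right-hand side forces a nonzero coefficient; \<open>s c\<close>
      differs from 1 because \<open>s\<close> is injective.\<close>
    have "(1 + c) * (1 + s c) \<noteq> 0"
      using \<open>c \<noteq> 1\<close> by (metis add_eq_0_iff_eq mult_eq_0_iff s_1 s_eq_iff)
    moreover have *: "(1 + c^2 * s c) * (x^2 + x) = (1 + c) * (1 + s c)"
      "(1 + c^2 * s c) * (b^2 + b) = (1 + c) * (1 + s c)"
      using det(2)[OF sx nz(2)] det(2)[OF sb nz(1)] four by simp_all
    ultimately have "1 + c^2 * s c \<noteq> 0"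
      by (metis mult_zero_left)
    then show ?thesis
      using * by (metis mult_left_cancel)
  qed
  then show ?thesis
    by (simp add: square_add_self_eq_iff)
qed

lemma FBCT_quot_one:
  assumes ss: "(\<forall>x. s (s x) = x^2) \<or> (\<forall>x. s (s x) = x^4)" and b: "b \<notin> {0, 1}"
  shows "FBCT quot 1 b = (if s b = b^2 then card {x. s x = x^2} else 0)"
proof -
  let ?S = "{x. quot x + quot (x + 1) + quot (x + b) + quot (x + 1 + b) = 0}"
  have nz: "b^2 + b \<noteq> 0"
    using b by (simp add: square_add_self_eq_0_iff)
  show ?thesis
  proof (cases "s b = b^2")
    case True
    have "x \<in> ?S \<longleftrightarrow> s x = x^2" for x
    proof (cases "x \<in> {0, 1, b, b + 1}")
      case special: True
      \<comment> \<open>The solutions of \<open>s x = x^2\<close> are closed under addition and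
        contain 1 and \<open>b\<close>.\<close>
      have "s x = x^2"
        using special True by (auto simp: s_add char2_simps)
      then show ?thesis
        using quot_sum_special[OF b special] True by simp
    next
      case False
      have "x \<in> ?S \<longleftrightarrow> (b^2 + b) * (s x + x) = (b^2 + b) * (x^2 + x)"
        using quot_sum_generic[OF False] True by simp
      then show ?thesis
        using nz by simp
    qed
    then have "?S = {x. s x = x^2}"
      by blast
    then show ?thesis
      using True by (simp add: FBCT_def)
  next
    case False
    have "x \<notin> ?S" for x
    proof (cases "x \<in> {0, 1, b, b + 1}")
      case True
      then show ?thesis
        using quot_sum_special[OF b True] False by simp
    next
      case generic: False
      then have "\<not> (x = b \<or> x = b + 1)" "x \<notin> {0, 1}"
        by auto
      then show ?thesis
        using proportional_imp_coset[OF ss b False, of x] quot_sum_generic[OF generic] by blast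
    qed
    then have "?S = {}"
      by blast
    then show ?thesis
      using False by (simp add: FBCT_def)
  qed
qed

lemma FBCT_quot:
  assumes ss: "(\<forall>x. s (s x) = x^2) \<or> (\<forall>x. s (s x) = x^4)" and ab: "a * b * (a + b) \<noteq> 0"
  shows "FBCT quot a b = (if s (b / a) = (b / a)^2 then card {x. s x = x^2} else 0)"
proof -
  have "a \<noteq> 0" "b / a \<notin> {0, 1}"
    using ab by (auto simp: add_eq_0_iff_eq)
  moreover have "quot a \<noteq> 0"
    using \<open>a \<noteq> 0\<close> by (simp add: quot_def)
  ultimately show ?thesis
    using FBCT_scale[OF quot_mult, of a b] FBCT_quot_one[OF ss, of "b / a"] by simp
qed

end

section \<open>The uniformity of the power map\<close>

lemma obtain_not_0_1:
  assumes "card (A :: 'a::zero_neq_one set) > 2"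
  obtains b where "b \<in> A" "b \<notin> {0, 1}"
proof -
  have "\<not> A \<subseteq> {0, 1}"
    using assms card_mono[of "{0, 1::'a}" A] by auto
  then show ?thesis
    using that by blast
qed

theorem corollary1:
  fixes m n :: nat and F :: "'a::{field,finite} \<Rightarrow> 'a"
  assumes m_pos: "m > 0"
    and n_cases: "n = 2 * m \<or> n = 2 * m + 1"
    and n_not_2: "n \<noteq> 2"
    and card_field: "CARD('a) = 2 ^ n"
    and F_def: "F = (\<lambda>x. x ^ (2 ^ (m + 1) - 1))"
  shows "feistel_boomerang_uniformity F = (if n = 2 * m then 2 ^ m else 0)"
proof -
  define s where "s = (\<lambda>x::'a. x ^ 2 ^ (m + 1))"
  have char2: "CHAR('a) = 2"
    using card_field by (rule CHAR_eq_2)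
  interpret char2_endomorphism s
  proof
    show "s (x + y) = s x + s y" for x y
      unfolding s_def by (rule power_2_power_add_CHAR_2[OF char2])
  qed (simp_all add: s_def char2 power_mult_distrib)
  have F: "F = quot"
  proof
    fix x
    have "(2::nat) ^ (m + 1) = Suc (2 ^ (m + 1) - 1)"
      by simp
    then have "s x = x * F x"
      unfolding s_def F_def by (metis power_Suc)
    then show "F x = quot x"
      \<comment> \<open>At 0 the exponent is positive, so both sides vanish.\<close>
      using m_pos one_less_power[of "2::nat" "m + 1"]
      by (cases "x = 0") (simp_all add: quot_def F_def power_0_left)
  qed
  have frob: "x ^ 2 ^ n = x" for x :: 'a
    using finite_field_power_CARD[of x] by (simp add: card_field)
  have s_s: "s (s x) = x ^ 2 ^ (2 * m + 2)" for x
  proof -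
    have "(2::nat) ^ (2 * m + 2) = 2 ^ (m + 1) * 2 ^ (m + 1)"
      by (simp flip: power_add)
    then show ?thesis
      by (simp only: s_def power_mult)
  qed
  \<comment> \<open>The exponent \<open>2 * m + 2\<close> is \<open>n + 2\<close> or
    \<open>n + 1\<close>, and \<open>x ^ 2 ^ n = x\<close>.\<close>
  have s_s_cases: "s (s x) = (if n = 2 * m then x^4 else x^2)" for x
  proof (cases "n = 2 * m")
    case True
    then have "s (s x) = (x ^ 2 ^ n)^4"
      by (simp add: s_s mult.commute flip: power_mult)
    then show ?thesis
      unfolding frob using True by simp
  next
    case False
    then have "s (s x) = (x ^ 2 ^ n)^2"
      using n_cases by (simp add: s_s mult.commute flip: power_mult)
    then show ?thesis
      unfolding frob using False by simp
  qed
  then have "(\<forall>x. s (s x) = x^2) \<or> (\<forall>x. s (s x) = x^4)"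
    by (cases "n = 2 * m") simp_all
  note FBCT = FBCT_quot[OF this, folded F]
  have adm: "1 * b * (1 + b) \<noteq> 0" if "b \<notin> {0, 1}" for b :: 'a
    using that by (auto simp: add_eq_0_iff_eq)
  define V where "V = {FBCT F a b |a b. a * b * (a + b) \<noteq> 0}"
  then have uniformity: "feistel_boomerang_uniformity F = Max V"
    by (simp add: feistel_boomerang_uniformity_def)
  have V_I: "FBCT F 1 b \<in> V" if "b \<notin> {0, 1}" for b
    using adm[OF that] unfolding V_def by blast
  show ?thesis
  proof (cases "n = 2 * m")
    case True
    then have "m \<ge> 2"
      using m_pos n_not_2 by simp
    \<comment> \<open>Both sides are squares, and squaring is injective in characteristic 2.\<close>
    have "s x = x^2 \<longleftrightarrow> x ^ 2 ^ m = x" for x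
    proof -
      have "s x = (x ^ 2 ^ m)^2"
        by (simp add: s_def mult.commute flip: power_mult)
      moreover have "(x ^ 2 ^ m)^2 + x^2 = (x ^ 2 ^ m + x)^2"
        by (simp add: char2_simps)
      ultimately show ?thesis
        by (metis add_eq_0_iff_eq power_eq_0_iff zero_neq_numeral)
    qed
    then have card_K: "card {x. s x = x^2} = 2 ^ m"
      using card_subfield[where ?'a = 'a and m = m] card_field True m_pos by simp
    \<comment> \<open>For \<open>m = 1\<close> the subfield would be \<open>{0, 1}\<close> and
      contain no admissible \<open>b\<close>; this is where \<open>n_not_2\<close> enters.\<close>
    also have "(2::nat) ^ m > 2"
      using \<open>m \<ge> 2\<close> power_strict_increasing[of 1 m "2::nat"] by simp
    finally obtain b where "s b = b^2" and b: "b \<notin> {0, 1}"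
      using obtain_not_0_1[of "{x. s x = x^2}"] by auto
    then have "FBCT F 1 b = 2 ^ m"
      using FBCT[OF adm[OF b]] card_K by simp
    then have "2 ^ m \<in> V"
      using V_I[OF b] by simp
    moreover have "v \<le> 2 ^ m" if "v \<in> V" for v
    proof -
      obtain a b where "v = FBCT F a b" "a * b * (a + b) \<noteq> 0"
        using \<open>v \<in> V\<close> unfolding V_def by blast
      then show ?thesis
        using FBCT[of a b] card_K by simp
    qed
    moreover from this have "finite V"
      by (intro finite_subset[of V "{..2 ^ m}"] subsetI atMost_iff[THEN iffD2] finite_atMost)
    ultimately have "Max V = 2 ^ m"
      by (intro Max_eqI)
    then show ?thesis
      using True by (simp add: uniformity)
  next
    case False
    have "s b \<noteq> b^2" if "b \<notin> {0, 1}" for b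
    proof
      assume sb: "s b = b^2"
      \<comment> \<open>Computing \<open>s (s b)\<close> in two ways gives \<open>b^4 = b^2\<close>,
        which only 0 and 1 satisfy.\<close>
      have "s (s b) = (s b)^2"
        by (simp add: sb power2_eq_square s_mult)
      then have "(b^2)^2 = b^2"
        using s_s_cases[of b] False sb by simp
      moreover have "(b^2 + b)^2 = (b^2)^2 + b^2"
        by (simp add: char2_simps)
      ultimately have "(b^2 + b)^2 = 0"
        by simp
      then show False
        using that by (simp add: square_add_self_eq_0_iff)
    qed
    then have zero: "FBCT F a b = 0" if "a * b * (a + b) \<noteq> 0" for a b
      using FBCT[OF that] that by (auto simp: add_eq_0_iff_eq)
    \<comment> \<open>An admissible pair must exist for \<open>V\<close> to be nonempty and its
      \<open>Max\<close> to be 0.\<close>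
    have "(2::nat) ^ n > 2"
      using False n_cases m_pos power_strict_increasing[of 1 n "2::nat"] by simp
    then obtain b :: 'a where "b \<notin> {0, 1}"
      using obtain_not_0_1[of "UNIV :: 'a set"] card_field by auto
    then have "FBCT F 1 b \<in> V"
      by (rule V_I)
    moreover have "V \<subseteq> {0}"
    proof
      fix v assume "v \<in> V"
      then obtain a b where "v = FBCT F a b" "a * b * (a + b) \<noteq> 0"
        unfolding V_def by blast
      then show "v \<in> {0}"
        using zero[of a b] by simp
    qed
    ultimately have "V = {0}"
      by (metis empty_iff subset_singletonD)
    then show ?thesis
      using False by (simp add: uniformity)
  qed
qed

end
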